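(* Let $\mathfrak{M}:=(V,\langle\cdot,\cdot\rangle,A)$ be a Riemannian $0$-model. (1) $\mathfrak{M}$ is skew Tsankov if and only if there exists an orthogonal direct sum decomposition $V=V_1\oplus\dots\oplus V_k\oplus W$ (with $k\ge 0$; $W$ may be zero) decomposing $A=A_1\oplus\dots\oplus A_k\oplus 0$, where $\dim(V_i)=2$ for all $i$. (2) $\mathfrak{M}$ is skew Tsankov and indecomposable if and only if $\dim(V)=2$ and $A\ne 0$.
   Context: A $0$-model is a triple $\mathfrak{M}=(V,\langle\cdot,\cdot\rangle,A)$ where $V$ is a real vector space of finite dimension $m$, $\langle\cdot,\cdot\rangle$ is a non-degenerate symmetric bilinear form on $V$ of signature $(p,q)$, and $A\in\otimes^4V^*$ is an algebraic curvature tensor, i.e. for all $x,y,z,w\in V$: $A(x,y,z,w)=A(z,w,x,y)=-A(y,x,z,w)$ and $A(x,y,z,w)+A(y,z,x,w)+A(z,x,y,w)=0$. It is Riemannian if $p=0$, i.e. if $\langle\cdot,\cdot\rangle$ is positive definite. The skew-symmetric curvature operator $\mathcal{A}(x,y):V\to V$ is defined by $\langle\mathcal{A}(x,y)z,w\rangle=A(x,y,z,w)$. The model is skew Tsankov if $\mathcal{A}(x,y)\mathcal{A}(u,v)=\mathcal{A}(u,v)\mathcal{A}(x,y)$ for all $x,y,u,v\in V$. An orthogonal direct sum decomposition $V=V_1\oplus\dots\oplus V_n$ decomposes $A=A_1\oplus\dots\oplus A_n$, where $A_i$ is an algebraic curvature tensor on $V_i$, if $A(x,y,z,w)=\sum_i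 A_i(x_i,y_i,z_i,w_i)$, where $x_i$ denotes the component of $x$ in $V_i$ (and similarly for the other vectors). In particular the summand $0$ on $W$ means the zero tensor on $W$. $\mathfrak{M}$ is decomposable if there is a non-trivial orthogonal direct sum decomposition $V=V_1\oplus V_2$ (both summands non-zero) which induces a decomposition $A=A_1\oplus A_2$; it is indecomposable otherwise.
   Formalization: Part (2) is stated only for dim(V) ≥ 2: when dim(V) is 0 or 1, A = 0 and the model is trivially skew Tsankov and indecomposable although dim(V) ≠ 2, so the equivalence fails in exactly these cases. *)

theory Defs
  imports "HOL-Analysis.Analysis"
begin

type_synonym 'a tensor4 = "'a \<Rightarrow> 'a \<Rightarrow> 'a \<Rightarrow> 'a \<Rightarrow> real"

text \<open>
  The summands of a decomposition are subspaces \<open>S\<close> of one ambient type, so tensors on \<open>S\<close> are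
  functions on the ambient type whose values outside \<open>S\<close> are irrelevant.
  For \<open>S = UNIV\<close>, \<open>linear_form_on S\<close> is \<open>linear\<close>.
\<close>

definition linear_form_on :: "'a::real_vector set \<Rightarrow> ('a \<Rightarrow> real) \<Rightarrow> bool" where
  "linear_form_on S f \<longleftrightarrow>
     (\<forall>x\<in>S. \<forall>y\<in>S. f (x + y) = f x + f y) \<and> (\<forall>c. \<forall>x\<in>S. f (c *\<^sub>R x) = c * f x)"

definition quadrilinear_on :: "'a::real_vector set \<Rightarrow> 'a tensor4 \<Rightarrow> bool" where
  "quadrilinear_on S A \<longleftrightarrow>
     (\<forall>x\<in>S. \<forall>y\<in>S. \<forall>z\<in>S.
        linear_form_on S (\<lambda>t. A t x y z) \<and> linear_form_on S (\<lambda>t. A x t y z) \<and>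
        linear_form_on S (\<lambda>t. A x y t z) \<and> linear_form_on S (\<lambda>t. A x y z t))"

definition algebraic_curvature_tensor_on :: "'a::real_vector set \<Rightarrow> 'a tensor4 \<Rightarrow> bool" where
  "algebraic_curvature_tensor_on S A \<longleftrightarrow>
     quadrilinear_on S A \<and>
     (\<forall>x\<in>S. \<forall>y\<in>S. \<forall>z\<in>S. \<forall>w\<in>S.
        A x y z w = A z w x y \<and> A x y z w = - A y x z w \<and>
        A x y z w + A y z x w + A z x y w = 0)"

text \<open>
  The vector space is the whole type \<open>'a\<close>; its dimension is finite but otherwise arbitrary
  (zero included).
\<close>

locale zero_model =
  fixes g :: "'a::real_vector \<Rightarrow> 'a \<Rightarrow> real"
    and A :: "'a tensor4"
  assumes finite_dimensional: "\<exists>B::'a set. finite B \<and> span B = UNIV"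
    and bilinear_form: "bilinear g"
    and symmetric_form: "g x y = g y x"
    and nondegenerate_form: "(\<And>y. g x y = 0) \<Longrightarrow> x = 0"
    and curvature_tensor: "algebraic_curvature_tensor_on UNIV A"

locale riemannian_zero_model = zero_model +
  assumes positive_definite: "x \<noteq> 0 \<Longrightarrow> 0 < g x x"

text \<open>Existence and uniqueness of the vector below follow from non-degeneracy of \<open>g\<close>.\<close>

definition skew_curvature_operator ::
    "('a::real_vector \<Rightarrow> 'a \<Rightarrow> real) \<Rightarrow> 'a tensor4 \<Rightarrow> 'a \<Rightarrow> 'a \<Rightarrow> 'a \<Rightarrow> 'a" where
  "skew_curvature_operator g A x y z = (THE u. \<forall>w. g u w = A x y z w)"

definition skew_tsankov :: "('a::real_vector \<Rightarrow> 'a \<Rightarrow> real) \<Rightarrow> 'a tensor4 \<Rightarrow> bool" where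
  "skew_tsankov g A \<longleftrightarrow>
     (\<forall>x y u v. skew_curvature_operator g A x y \<circ> skew_curvature_operator g A u v
              = skew_curvature_operator g A u v \<circ> skew_curvature_operator g A x y)"

text \<open>
  An ordered family of summands is a list of subspaces; \<open>list_all2 (\<in>) xs Vs\<close> says that \<open>xs\<close> is a
  list of vectors, one from each summand, so that \<open>xs\<close> is the list of components of \<open>sum_list xs\<close>.
\<close>

definition orthogonal_direct_sum ::
    "('a::real_vector \<Rightarrow> 'a \<Rightarrow> real) \<Rightarrow> 'a set list \<Rightarrow> bool" where
  "orthogonal_direct_sum g Vs \<longleftrightarrow>
     (\<forall>S\<in>set Vs. subspace S) \<and>
     (\<forall>x. \<exists>!xs. list_all2 (\<in>) xs Vs \<and> x = sum_list xs) \<and>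
     (\<forall>i<length Vs. \<forall>j<length Vs. i \<noteq> j \<longrightarrow> (\<forall>x\<in>Vs ! i. \<forall>y\<in>Vs ! j. g x y = 0))"

definition decomposes_tensor ::
    "'a::real_vector set list \<Rightarrow> 'a tensor4 \<Rightarrow> 'a tensor4 list \<Rightarrow> bool" where
  "decomposes_tensor Vs A As \<longleftrightarrow>
     list_all2 algebraic_curvature_tensor_on Vs As \<and>
     (\<forall>xs ys zs ws.
        list_all2 (\<in>) xs Vs \<and> list_all2 (\<in>) ys Vs \<and> list_all2 (\<in>) zs Vs \<and> list_all2 (\<in>) ws Vs \<longrightarrow>
        A (sum_list xs) (sum_list ys) (sum_list zs) (sum_list ws) =
          (\<Sum>i<length Vs. (As ! i) (xs ! i) (ys ! i) (zs ! i) (ws ! i)))"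

definition zero_tensor :: "'a tensor4" where
  "zero_tensor = (\<lambda>x y z w. 0)"

definition decomposable :: "('a::real_vector \<Rightarrow> 'a \<Rightarrow> real) \<Rightarrow> 'a tensor4 \<Rightarrow> bool" where
  "decomposable g A \<longleftrightarrow>
     (\<exists>V1 V2 A1 A2. V1 \<noteq> {0} \<and> V2 \<noteq> {0} \<and>
        orthogonal_direct_sum g [V1, V2] \<and> decomposes_tensor [V1, V2] A [A1, A2])"

end

theory Submission
  imports Defs "HOL-Computational_Algebra.Fundamental_Theorem_Algebra"
begin

text \<open>
  For fixed \<open>x\<close> and \<open>y\<close> the curvature operator \<open>R x y\<close> is skew-adjoint, and the skew Tsankov condition
  says that all these operators commute.  A commuting family of skew-adjoint operators on a Euclidean
  space splits the space orthogonally into planes, on each of which every operator is a multiple of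
  the same rotation by a right angle, and a subspace on which all of them vanish.  The splitting is
  built by peeling off one plane at a time (\<open>tsankov_invariant_plane\<close>): products \<open>R x y \<circ> R u v\<close> are
  self-adjoint and commute with each other, so they have a common eigenvector \<open>v\<close>, which can be taken
  in the image of a nonzero \<open>J = R s t\<close>, where \<open>J\<close> is injective; then the plane spanned by \<open>v\<close> and \<open>J v\<close>
  is invariant under every \<open>R x y\<close>, and its orthogonal complement is invariant by skewness.

  Linear algebra alone allows \<open>R x y\<close> to act on one plane when \<open>x\<close> and \<open>y\<close> lie in another.  The Bianchi
  identity excludes this: for orthogonal invariant subspaces \<open>S\<close> and \<open>T\<close>, invariance makes \<open>A x y z w\<close>
  vanish as soon as \<open>z\<close> and \<open>w\<close>, or \<open>x\<close> and \<open>y\<close>, are separated by \<open>S\<close> and \<open>T\<close>, and if \<open>x, y\<close> are in \<open>S\<close>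
  and \<open>z, w\<close> in \<open>T\<close>, then the other two entries of the cyclic sum are separated in this way
  (\<open>curvature_splits\<close>).  Hence an orthogonal splitting into invariant subspaces decomposes the tensor.

  Conversely, each summand of a decomposition is invariant under all curvature operators, and two
  skew-adjoint operators on a plane commute because they are multiples of one rotation.

  For the second part, an invariant subspace and its complement always decompose the model, so an
  indecomposable model has no invariant subspace other than zero and everything.  If \<open>A\<close> is nonzero,
  the invariant plane found above must be the whole space; if \<open>A\<close> is zero, every line is invariant,
  and the dimension is at most one.  In dimension two a proper decomposition has invariant lines, on which
  skew-adjoint operators vanish.
\<close>

section \<open>Real polynomials in a linear operator\<close>

text \<open>
  \<open>poly_apply p T v\<close> is \<open>p(T) v\<close>, computed by the Horner scheme as \<^const>\<open>poly\<close> is.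
\<close>

definition poly_apply :: "real poly \<Rightarrow> ('a::real_vector \<Rightarrow> 'a) \<Rightarrow> 'a \<Rightarrow> 'a" where
  "poly_apply p T v = fold_coeffs (\<lambda>a w. a *\<^sub>R v + T w) p 0"

context
  fixes T :: "'a::real_vector \<Rightarrow> 'a"
  assumes T: "linear T"
begin

lemma poly_apply_0 [simp]: "poly_apply 0 T v = 0"
  by (simp add: poly_apply_def)

lemma poly_apply_pCons [simp]: "poly_apply (pCons a p) T v = a *\<^sub>R v + T (poly_apply p T v)"
  by (cases "a = 0 \<and> p = 0") (auto simp: poly_apply_def linear_0[OF T])

lemma poly_apply_add: "poly_apply (p + q) T v = poly_apply p T v + poly_apply q T v"
  by (induction p q rule: poly_induct2) (simp_all add: linear_add[OF T] algebra_simps)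

lemma poly_apply_smult: "poly_apply (smult c p) T v = c *\<^sub>R poly_apply p T v"
  by (induction p) (simp_all add: linear_scale[OF T] algebra_simps)

lemma poly_apply_mult: "poly_apply (p * q) T v = poly_apply p T (poly_apply q T v)"
  by (induction p) (simp_all add: poly_apply_add poly_apply_smult)

lemma poly_apply_monom: "poly_apply (monom c n) T v = c *\<^sub>R (T ^^ n) v"
  by (induction n) (simp_all add: monom_0 monom_Suc linear_0[OF T] linear_scale[OF T])

lemma poly_apply_sum: "poly_apply (sum p I) T v = (\<Sum>i\<in>I. poly_apply (p i) T v)"
  by (induction I rule: infinite_finite_induct) (simp_all add: poly_apply_add)

lemma poly_apply_in_subspace:
  assumes "subspace U" "T ` U \<subseteq> U" "v \<in> U"
  shows "poly_apply p T v \<in> U"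
  using assms by (induction p) (auto intro!: subspace_add subspace_scale simp: subspace_0)

text \<open>
  The orbit of \<open>v\<close> either repeats, or is an infinite set in a finite-dimensional space and so satisfies
  a linear relation.
\<close>

lemma annihilating_poly_exists:
  assumes "\<exists>B::'a set. finite B \<and> span B = UNIV"
  shows "\<exists>p. p \<noteq> 0 \<and> poly_apply p T v = 0"
proof (cases "inj (\<lambda>i. (T ^^ i) v)")
  case False
  then obtain i j where ij: "i \<noteq> j" "(T ^^ i) v = (T ^^ j) v"
    by (auto simp: inj_def)
  have "poly_apply (monom 1 i + monom (-1) j) T v = 0"
    unfolding poly_apply_add poly_apply_monom using ij by simp
  moreover have "coeff (monom 1 i + monom (-1::real) j) i \<noteq> 0"
    using ij by simp
  ultimately show ?thesis by (metis coeff_0)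
next
  case True
  let ?r = "\<lambda>i. (T ^^ i) v"
  obtain B :: "'a set" where B: "finite B" "span B = UNIV" using assms by blast
  have "infinite (range ?r)" using True by (simp add: finite_image_iff)
  then have "dependent (range ?r)"
    using independent_span_bound[OF B(1), of "range ?r"] B(2) by auto
  then obtain S c where S: "finite S" "S \<subseteq> range ?r" "(\<Sum>w\<in>S. c w *\<^sub>R w) = 0"
      and c: "\<exists>w\<in>S. c w \<noteq> (0::real)"
    unfolding dependent_explicit by blast
  define I where "I = ?r -` S"
  have I: "finite I" "?r ` I = S"
    using S True by (auto simp: I_def intro: finite_vimageI)
  define p where "p = (\<Sum>i\<in>I. monom (c (?r i)) i)"
  have "poly_apply p T v = (\<Sum>i\<in>I. c (?r i) *\<^sub>R ?r i)"
    by (simp add: p_def poly_apply_sum poly_apply_monom)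
  also have "\<dots> = (\<Sum>w\<in>S. c w *\<^sub>R w)"
    unfolding I(2)[symmetric] using True
    by (subst sum.reindex) (auto simp: inj_def inj_on_def)
  finally have "poly_apply p T v = 0" using S by simp
  moreover obtain i where i: "i \<in> I" "c (?r i) \<noteq> 0" using c I by auto
  have "coeff p i = c (?r i)" using I(1) i(1) by (simp add: p_def coeff_sum)
  with i have "p \<noteq> 0" by auto
  ultimately show ?thesis by blast
qed

end

text \<open>
  Evaluation of a real polynomial at a complex number is the case of the operator \<open>(*) z\<close> on the real
  vector space of complex numbers; this transfers multiplicativity of \<^const>\<open>poly_apply\<close> to such
  evaluations.
\<close>

lemma poly_apply_times_eq_poly:
  "poly_apply p ((*) z) 1 = poly (map_poly complex_of_real p) z"
  by (induction p) (simp_all add: map_poly_pCons bounded_linear.linear[OF bounded_linear_mult_right]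
      scaleR_conv_of_real)

lemma poly_map_poly_of_real:
  "poly (map_poly complex_of_real p) (complex_of_real x) = complex_of_real (poly p x)"
  by (induction p) (simp_all add: map_poly_pCons)

text \<open>
  A complex root \<open>z\<close> gives the factor \<open>X - z\<close> if it is real, and otherwise the product
  \<open>(X - Re z)\<^sup>2 + (Im z)\<^sup>2\<close> of \<open>X - z\<close> with its conjugate: the remainder modulo this quadratic is a real
  polynomial of degree at most one that vanishes at a nonreal number.
\<close>

lemma real_poly_has_low_degree_factor:
  fixes p :: "real poly"
  assumes "degree p > 0"
  shows "\<exists>a b q. p = [:- a, 1:] * q \<or> b \<noteq> 0 \<and> p = [:a\<^sup>2 + b\<^sup>2, - 2 * a, 1:] * q"
proof -
  let ?c = "map_poly complex_of_real p"
  have "degree ?c > 0" using assms by (simp add: degree_map_poly)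
  then obtain z where z: "poly ?c z = 0"
    using fundamental_theorem_of_algebra[of ?c] by (auto simp: constant_degree)
  show ?thesis
  proof (cases "Im z = 0")
    case True
    then have "z = complex_of_real (Re z)" by (simp add: complex_eq_iff)
    then have "complex_of_real (poly p (Re z)) = 0"
      using z poly_map_poly_of_real by metis
    then have "[:- Re z, 1:] dvd p" by (simp add: poly_eq_0_iff_dvd)
    then show ?thesis unfolding dvd_def by blast
  next
    case False
    let ?d = "[:(Re z)\<^sup>2 + (Im z)\<^sup>2, - 2 * Re z, 1:]"
    let ?r = "p mod ?d"
    have lin: "linear ((*) z)" by (simp add: bounded_linear.linear[OF bounded_linear_mult_right])
    have "poly_apply ?d ((*) z) w = 0" for w
      by (simp add: lin complex_eq_iff power2_eq_square algebra_simps)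
    then have "poly_apply (?d * (p div ?d)) ((*) z) 1 = 0"
      by (simp only: poly_apply_mult[OF lin])
    moreover have "poly_apply (?d * (p div ?d) + ?r) ((*) z) 1 = 0"
      using z by (simp only: poly_apply_times_eq_poly mult_div_mod_eq)
    ultimately have "poly_apply ?r ((*) z) 1 = 0" by (simp only: poly_apply_add[OF lin]) simp
    moreover have "degree ?r < 2" using degree_mod_less[of ?d p] by auto
    then obtain c0 c1 where r: "?r = [:c0, c1:]"
    proof -
      obtain c0 r' where c0: "?r = pCons c0 r'" by (rule pCons_cases)
      with \<open>degree ?r < 2\<close> have "degree r' = 0" by (cases "r' = 0") auto
      then obtain c1 where "r' = [:c1:]" by (rule degree_eq_zeroE)
      with c0 that show ?thesis by simp
    qed
    ultimately have "c0 + c1 * Re z = 0" "c1 * Im z = 0" by (simp_all add: lin complex_eq_iff)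
    with False r have "?r = 0" by simp
    then have "p = ?d * (p div ?d)" by (metis mult_div_mod_eq add.right_neutral)
    with False show ?thesis by blast
  qed
qed

section \<open>Vector spaces and lists of summands\<close>

lemma dim_pos_imp_nonzero_vector:
  fixes S :: "'a::real_vector set"
  assumes "dim S > 0"
  shows "\<exists>e\<in>S. e \<noteq> 0"
proof (rule ccontr)
  assume "\<not> (\<exists>e\<in>S. e \<noteq> 0)"
  then have "S \<subseteq> span {}" by auto
  from dim_le_card[OF this] show False using assms by simp
qed

lemma span_pair_cases:
  assumes "x \<in> span {e, f}"
  obtains a b where "x = a *\<^sub>R e + b *\<^sub>R f"
  using assms by (auto simp: span_breakdown_eq span_singleton diff_eq_eq)
    (metis add.commute)

lemma sum_list_in_span_Union:
  fixes xs :: "'a::real_vector list"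
  assumes "list_all2 (\<in>) xs Vs"
  shows "sum_list xs \<in> span (\<Union>(set Vs))"
  using assms
proof (induction xs Vs rule: list_all2_induct)
  case (Cons x xs V Vs)
  have "x \<in> span (\<Union>(set (V # Vs)))" using Cons(1) by (auto intro: span_base)
  moreover have "sum_list xs \<in> span (\<Union>(set (V # Vs)))"
    using Cons.IH span_mono[of "\<Union>(set Vs)" "\<Union>(set (V # Vs))"] by auto
  ultimately show ?case by (simp add: span_add)
qed (simp add: span_0)

lemma linear_eq_on_sum_list:
  assumes "linear f" "linear h" "\<And>z. z \<in> set zs \<Longrightarrow> f z = h z"
  shows "f (sum_list zs) = h (sum_list zs)"
  using assms(3) by (induction zs) (simp_all add: assms(1,2) linear_0 linear_add)

lemma sum_list_single:
  fixes z :: "'a::comm_monoid_add"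
  assumes "i < n"
  shows "sum_list ((replicate n 0)[i := z]) = z"
  using assms by (simp add: sum_list_sum_nth nth_list_update sum.delta cong: if_cong)

lemma single_in_summands:
  assumes "\<forall>S\<in>set Us. subspace S" "i < length Us" "z \<in> Us ! i"
  shows "list_all2 (\<in>) ((replicate (length Us) 0)[i := z]) Us"
  using assms by (auto simp: list_all2_conv_all_nth nth_list_update subspace_0)

lemma decomposes_tensor_zero_argument:
  assumes "decomposes_tensor Us A Bs" "i < length Us"
    and "x \<in> Us ! i" "y \<in> Us ! i" "z \<in> Us ! i"
  shows "(Bs ! i) x y 0 z = 0" "(Bs ! i) x y z 0 = 0"
proof -
  have "algebraic_curvature_tensor_on (Us ! i) (Bs ! i)"
    using assms(1,2) unfolding decomposes_tensor_def by (blast dest: list_all2_nthD)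
  then have lin: "linear_form_on (Us ! i) (\<lambda>t. (Bs ! i) x y t z)"
      "linear_form_on (Us ! i) (\<lambda>t. (Bs ! i) x y z t)"
    using assms(3-) unfolding algebraic_curvature_tensor_on_def quadrilinear_on_def by blast+
  have zero: "f 0 = 0" if "linear_form_on (Us ! i) f" for f
  proof -
    have "f (0 *\<^sub>R z) = 0 * f z" using that assms(5) unfolding linear_form_on_def by blast
    then show ?thesis by simp
  qed
  show "(Bs ! i) x y 0 z = 0" "(Bs ! i) x y z 0 = 0"
    using lin[THEN zero] by simp_all
qed

section \<open>Spectral theory of a positive definite form\<close>

locale euclidean_form =
  fixes g :: "'a::real_vector \<Rightarrow> 'a \<Rightarrow> real"
  assumes finite_spanning_set: "\<exists>B::'a set. finite B \<and> span B = UNIV"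
    and bilinear: "bilinear g"
    and symmetric: "g x y = g y x"
    and positive: "x \<noteq> 0 \<Longrightarrow> 0 < g x x"
begin

lemmas form_simps [simp] =
  bilinear_ladd[OF bilinear] bilinear_radd[OF bilinear]
  bilinear_lmul[OF bilinear] bilinear_rmul[OF bilinear]
  bilinear_lneg[OF bilinear] bilinear_rneg[OF bilinear]
  bilinear_lsub[OF bilinear] bilinear_rsub[OF bilinear]
  bilinear_lzero[OF bilinear] bilinear_rzero[OF bilinear]

lemma form_self_eq_0 [simp]: "g x x = 0 \<longleftrightarrow> x = 0"
  using positive[of x] by fastforce

lemma form_self_nonneg: "0 \<le> g x x"
  using positive[of x] by (cases "x = 0") auto

lemma form_eqI: "(\<And>w. g u w = g v w) \<Longrightarrow> u = v"
proof -
  assume "\<And>w. g u w = g v w"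
  then have "g (u - v) (u - v) = 0" by simp
  then show "u = v" unfolding form_self_eq_0 by simp
qed

lemma dim_psubspace:
  fixes S T :: "'a set"
  assumes "subspace S" "subspace T" "S \<subset> T"
  shows "dim S < dim T"
proof -
  obtain B :: "'a set" where B: "independent B" "UNIV \<subseteq> span B"
    by (rule basis_exists[of UNIV])
  have "finite B"
    using finite_spanning_set independent_span_bound[OF _ B(1)] by auto
  then interpret fd: finite_dimensional_vector_space "scaleR :: real \<Rightarrow> 'a \<Rightarrow> 'a" B
    using B by unfold_locales (auto simp: dependent_raw_def span_raw_def)
  show ?thesis
    using fd.dim_psubset[of S T] assms
    by (simp add: span_raw_def[symmetric] dim_raw_def[symmetric] span_eq_iff[THEN iffD2])
qed

text \<open>
  Low degree factors of \<open>p\<close> are stripped off one after the other.  When the remaining factor \<open>q\<close>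
  no longer annihilates \<open>u\<close>, the vector \<open>w = q(T) u\<close> is killed by \<open>T - a\<close>, hence an eigenvector, or by
  \<open>(T - a)\<^sup>2 + b\<^sup>2\<close>; but self-adjointness makes the latter strictly positive for \<open>b \<noteq> 0\<close>.
\<close>

lemma eigenvector_of_annihilating_poly:
  assumes T: "linear T" and sym: "\<And>x y. g (T x) y = g x (T y)"
    and U: "subspace U" "T ` U \<subseteq> U"
    and p: "p \<noteq> 0" "u \<in> U" "u \<noteq> 0" "poly_apply p T u = 0"
  shows "\<exists>v\<in>U. v \<noteq> 0 \<and> (\<exists>c. T v = c *\<^sub>R v)"
  using p
proof (induction "degree p" arbitrary: p rule: less_induct)
  case less
  show ?case
  proof (cases "degree p = 0")
    case True
    then obtain c where "p = [:c:]" by (rule degree_eq_zeroE)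
    with less.prems show ?thesis by (simp add: T linear_0[OF T])
  next
    case False
    then obtain a b q where dec:
      "p = [:- a, 1:] * q \<or> b \<noteq> 0 \<and> p = [:a\<^sup>2 + b\<^sup>2, - 2 * a, 1:] * q"
      using real_poly_has_low_degree_factor[of p] by blast
    then have "q \<noteq> 0" using less.prems(1) by auto
    then have deg: "degree q < degree p" using dec by (auto simp: degree_mult_eq simp del: mult_pCons_left)
    define w where "w = poly_apply q T u"
    show ?thesis
    proof (cases "w = 0")
      case True
      with less.hyps[OF deg \<open>q \<noteq> 0\<close>] less.prems show ?thesis by (simp add: w_def)
    next
      case False
      have "w \<in> U" unfolding w_def using U less.prems by (intro poly_apply_in_subspace[OF T])
      from dec show ?thesis
      proof
        assume "p = [:- a, 1:] * q"
        then have "poly_apply [:- a, 1:] T w = 0"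
          using less.prems(4) by (simp only: w_def poly_apply_mult[OF T])
        then have "T w = a *\<^sub>R w" by (simp add: T linear_0[OF T])
        with False \<open>w \<in> U\<close> show ?thesis by blast
      next
        assume *: "b \<noteq> 0 \<and> p = [:a\<^sup>2 + b\<^sup>2, - 2 * a, 1:] * q"
        define z where "z = T w - a *\<^sub>R w"
        have "poly_apply [:a\<^sup>2 + b\<^sup>2, - 2 * a, 1:] T w = 0"
          using less.prems(4) * by (simp only: w_def poly_apply_mult[OF T])
        then have "(a\<^sup>2 + b\<^sup>2) *\<^sub>R w + T (T w) - (2 * a) *\<^sub>R T w = 0"
          by (simp add: T linear_0[OF T] linear_add[OF T] linear_diff[OF T] linear_scale[OF T] algebra_simps)
        (* pairing with w turns the quadratic into a sum of squares *)
        then have "g ((a\<^sup>2 + b\<^sup>2) *\<^sub>R w + T (T w) - (2 * a) *\<^sub>R T w) w = 0"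
          by simp
        then have "g z z + b\<^sup>2 * g w w = 0"
          using sym[of "T w" w] symmetric[of "T w" w]
          by (simp add: z_def algebra_simps power2_eq_square)
        moreover have "0 < b\<^sup>2 * g w w" using * False positive by simp
        ultimately show ?thesis using form_self_nonneg[of z] by simp
      qed
    qed
  qed
qed

text \<open>
  An operator that is not scalar on \<open>U\<close> has a proper eigenspace in \<open>U\<close>, and operators commuting with it
  preserve this eigenspace, so the dimension can be lowered until all operators are scalar.
\<close>

lemma common_eigenvector:
  assumes F: "\<And>T. T \<in> F \<Longrightarrow> linear T"
    and sym: "\<And>T x y. T \<in> F \<Longrightarrow> g (T x) y = g x (T y)"
    and comm: "\<And>S T x. S \<in> F \<Longrightarrow> T \<in> F \<Longrightarrow> S (T x) = T (S x)"
    and U: "subspace U" "\<And>T. T \<in> F \<Longrightarrow> T ` U \<subseteq> U" "U \<noteq> {0}"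
  shows "\<exists>v\<in>U. v \<noteq> 0 \<and> (\<forall>T\<in>F. \<exists>c. T v = c *\<^sub>R v)"
  using U
proof (induction "dim U" arbitrary: U rule: less_induct)
  case less
  obtain u where u: "u \<in> U" "u \<noteq> 0" using less.prems(1,3) subspace_0 by blast
  show ?case
  proof (cases "\<forall>T\<in>F. \<exists>c. \<forall>v\<in>U. T v = c *\<^sub>R v")
    case True
    with u show ?thesis by blast
  next
    case False
    then obtain T where T: "T \<in> F" and not_scalar: "\<And>c. \<exists>v\<in>U. T v \<noteq> c *\<^sub>R v" by blast
    obtain p where "p \<noteq> 0" "poly_apply p T u = 0"
      using annihilating_poly_exists[OF F[OF T] finite_spanning_set] by blast
    then obtain v c where v: "v \<in> U" "v \<noteq> 0" "T v = c *\<^sub>R v"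
      using eigenvector_of_annihilating_poly[OF F[OF T] sym[OF T] less.prems(1) less.prems(2)[OF T]] u
      by blast
    define E where "E = {x \<in> U. T x = c *\<^sub>R x}"
    have E: "subspace E"
      using less.prems(1) F[OF T]
      by (auto simp: E_def subspace_def linear_0 linear_add linear_scale algebra_simps)
    moreover have "E \<subset> U" using not_scalar[of c] by (auto simp: E_def)
    moreover have "S ` E \<subseteq> E" if "S \<in> F" for S
      using less.prems(2)[OF that] comm[OF T that] linear_scale[OF F[OF that]]
      by (auto simp: E_def)
    moreover have "E \<noteq> {0}" using v by (auto simp: E_def)
    ultimately have "\<exists>v\<in>E. v \<noteq> 0 \<and> (\<forall>T\<in>F. \<exists>c. T v = c *\<^sub>R v)"
      using less.hyps[of E] dim_psubspace[OF E less.prems(1)] by blast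
    then show ?thesis by (auto simp: E_def)
  qed
qed

section \<open>Orthogonal projection and representing vectors\<close>

definition orthogonal_complement :: "'a set \<Rightarrow> 'a set" where
  "orthogonal_complement S = {x. \<forall>y\<in>S. g x y = 0}"

lemma subspace_orthogonal_complement: "subspace (orthogonal_complement S)"
  by (auto simp: orthogonal_complement_def subspace_def)

lemma orthogonal_complement_span: "orthogonal_complement (span S) = orthogonal_complement S"
proof -
  have "g x y = 0" if "\<forall>y\<in>S. g x y = 0" "y \<in> span S" for x y
    using that(2,1) by (induction rule: span_induct_alt) auto
  then show ?thesis by (auto simp: orthogonal_complement_def span_base)
qed

text \<open>
  Gram-Schmidt: adjoining \<open>b\<close> to a spanning set corrects the projection by the multiple of
  \<open>e = b - proj b\<close> dictated by \<open>g x e\<close>.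
\<close>

lemma orthogonal_projection_exists:
  assumes "subspace S"
  shows "\<exists>p\<in>S. x - p \<in> orthogonal_complement S"
proof -
  have *: "\<exists>p\<in>span B. x - p \<in> orthogonal_complement (span B)" if "finite B" for B x
    using that
  proof (induction B arbitrary: x)
    case empty
    show ?case by (simp add: orthogonal_complement_def)
  next
    case (insert b B)
    obtain p where p: "p \<in> span B" "x - p \<in> orthogonal_complement (span B)"
      using insert.IH by blast
    obtain q where q: "q \<in> span B" "b - q \<in> orthogonal_complement (span B)"
      using insert.IH by blast
    define e where "e = b - q"
    have sub: "span B \<subseteq> span (insert b B)" by (intro span_mono) auto
    have "b \<in> span (insert b B)" by (simp add: span_base)
    with q(1) sub have e: "e \<in> span (insert b B)"
      unfolding e_def by (blast intro: span_diff)
    (* for e = 0 the division by zero makes the correction vanish, as it should *)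
    define r where "r = p + (g x e / g e e) *\<^sub>R e"
    have "r \<in> span (insert b B)"
      unfolding r_def using p(1) e sub by (blast intro: span_add span_scale)
    moreover have "g (x - r) y = 0" if "y \<in> B" for y
      using that p(2) q(2) span_base[OF that] by (simp add: r_def e_def[symmetric] orthogonal_complement_def)
    moreover have "g (x - r) b = 0"
    proof -
      have "g p e = 0" "g (x - p) q = 0" "g e q = 0"
        using p q by (auto simp: e_def orthogonal_complement_def symmetric[of p])
      then have "g (x - r) q = 0" "g (x - r) e = 0"
        by (simp_all add: r_def)
      moreover have "b = q + e" by (simp add: e_def)
      ultimately show ?thesis by simp
    qed
    ultimately show ?case
      unfolding orthogonal_complement_span by (auto simp: orthogonal_complement_def intro!: bexI[of _ r])
  qed
  obtain B where B: "B \<subseteq> S" "independent B" "S \<subseteq> span B"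
    by (rule basis_exists[of S])
  have "finite B" using finite_spanning_set independent_span_bound[OF _ B(2)] by auto
  moreover have "span B = S" using B assms by (metis span_mono span_eq_iff subset_antisym)
  ultimately show ?thesis using * by blast
qed

text \<open>
  A vector orthogonal to the kernel of \<open>f\<close> represents \<open>f\<close> after rescaling.
\<close>

lemma riesz_representation:
  fixes f :: "'a \<Rightarrow> real"
  assumes f: "linear f"
  shows "\<exists>!u. \<forall>w. g u w = f w"
proof -
  have "\<exists>u. \<forall>w. g u w = f w"
  proof (cases "\<forall>x. f x = 0")
    case True
    then show ?thesis by (intro exI[of _ 0]) simp
  next
    case False
    then obtain x where x: "f x \<noteq> 0" by blast
    define K where "K = {w. f w = 0}"
    have "subspace K" using f by (auto simp: K_def subspace_def linear_0 linear_add linear_scale)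
    then obtain p where p: "p \<in> K" "x - p \<in> orthogonal_complement K"
      using orthogonal_projection_exists by blast
    define r where "r = x - p"
    have perp: "r \<in> orthogonal_complement K" using p(2) by (simp add: r_def)
    have fr: "f r \<noteq> 0" using x p(1) by (simp add: r_def K_def linear_diff[OF f])
    then have r: "r \<noteq> 0" using linear_0[OF f] by auto
    have "g ((f r / g r r) *\<^sub>R r) w = f w" for w
    proof -
      have "w - (f w / f r) *\<^sub>R r \<in> K"
        using fr by (simp add: K_def linear_diff[OF f] linear_scale[OF f])
      then have "g r (w - (f w / f r) *\<^sub>R r) = 0"
        using perp by (simp only: orthogonal_complement_def mem_Collect_eq)
      then have "g r w = f w / f r * g r r" by simp
      then show ?thesis using fr r by simp
    qed
    then show ?thesis by blast
  qed
  moreover have "u = v" if "\<forall>w. g u w = f w" "\<forall>w. g v w = f w" for u v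
    using that by (intro form_eqI) simp
  ultimately show ?thesis by blast
qed

section \<open>Skew-adjoint operators on a plane\<close>

lemma dim_span_orthogonal_pair:
  assumes "e \<noteq> 0" "f \<noteq> 0" "g e f = 0"
  shows "dim (span {e, f}) = 2"
proof -
  have "e \<notin> span {f}"
  proof
    assume "e \<in> span {f}"
    then obtain c where "e = c *\<^sub>R f" by (auto simp: span_singleton)
    with assms show False by auto
  qed
  then have "independent {e, f}" "e \<noteq> f"
    using assms by (auto simp: independent_insert)
  then show ?thesis by (simp add: dim_span_eq_card_independent del: dim_span)
qed

lemma plane_has_orthogonal_basis:
  fixes P :: "'a set"
  assumes "subspace P" "dim P = 2"
  shows "\<exists>e f. e \<noteq> 0 \<and> f \<noteq> 0 \<and> g e f = 0 \<and> P = span {e, f}"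
proof -
  obtain e where e: "e \<in> P" "e \<noteq> 0" using dim_pos_imp_nonzero_vector[of P] assms(2) by auto
  have "span {e} \<subseteq> P" using e(1) assms(1) by (simp add: span_minimal)
  moreover have "dim (span {e}) = 1" using e(2) by (simp add: dim_span_eq_card_independent del: dim_span)
  ultimately have "\<not> P \<subseteq> span {e}" using assms(2) by (metis subset_antisym numeral_eq_one_iff semiring_norm(85))
  then obtain x where x: "x \<in> P" "x \<notin> span {e}" by blast
  obtain p where p: "p \<in> span {e}" "x - p \<in> orthogonal_complement (span {e})"
    using orthogonal_projection_exists[OF subspace_span] by blast
  define f where "f = x - p"
  have "p \<in> P" using p(1) \<open>span {e} \<subseteq> P\<close> by blast
  then have f: "f \<noteq> 0" "f \<in> P" "g e f = 0"
    using x p subspace_diff[OF assms(1)] span_base[of e "{e}"] symmetric[of e p] symmetric[of e x]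
    by (auto simp: f_def orthogonal_complement_def)
  have "span {e, f} \<subseteq> P" using e(1) f(2) assms(1) by (simp add: span_minimal)
  then have "span {e, f} = P"
    using dim_psubspace[OF subspace_span assms(1)] dim_span_orthogonal_pair[OF e(2) f(1,3)] assms(2)
    by (metis less_irrefl psubsetI)
  with e f show ?thesis by blast
qed

text \<open>
  The matrix of \<open>K\<close> has a zero diagonal, and its two remaining entries determine each other.  The ratio
  \<open>g f f / g e e\<close>, which depends only on the basis, appears because the basis is not normalised.
\<close>

lemma skew_on_orthogonal_basis:
  assumes skew: "\<And>x y. g (K x) y = - g x (K y)"
    and e: "e \<noteq> 0" "f \<noteq> 0" "g e f = 0" "K e \<in> span {e, f}" "K f \<in> span {e, f}"
  shows "\<exists>b. K e = b *\<^sub>R f \<and> K f = (- b * (g f f / g e e)) *\<^sub>R e"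
proof -
  obtain a b where ab: "K e = a *\<^sub>R e + b *\<^sub>R f" using e(4) by (rule span_pair_cases)
  obtain c d where cd: "K f = c *\<^sub>R e + d *\<^sub>R f" using e(5) by (rule span_pair_cases)
  have fe: "g f e = 0" using e(3) symmetric by simp
  have "g (K e) e = 0" "g (K f) f = 0" using skew[of e e] skew[of f f] symmetric by simp_all
  then have "a = 0" "d = 0" using ab cd e fe by simp_all
  moreover have "b * g f f = - c * g e e"
    using skew[of e f] ab cd e(3) fe by simp
  then have "c = - b * (g f f / g e e)" using e(1) by (simp add: field_simps)
  ultimately show ?thesis using ab cd by auto
qed

lemma skew_operators_commute_on_plane:
  assumes lin: "linear K" "linear L"
    and skew: "\<And>x y. g (K x) y = - g x (K y)" "\<And>x y. g (L x) y = - g x (L y)"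
    and P: "subspace P" "dim P = 2" "K ` P \<subseteq> P" "L ` P \<subseteq> P" and p: "p \<in> P"
  shows "K (L p) = L (K p)"
proof -
  obtain e f where ef: "e \<noteq> 0" "f \<noteq> 0" "g e f = 0" and span: "P = span {e, f}"
    using plane_has_orthogonal_basis[OF P(1,2)] by blast
  have "e \<in> P" "f \<in> P" by (simp_all add: span span_base)
  then have mem: "K e \<in> span {e, f}" "K f \<in> span {e, f}" "L e \<in> span {e, f}" "L f \<in> span {e, f}"
    using P(3,4) span by blast+
  obtain b where K: "K e = b *\<^sub>R f" "K f = (- b * (g f f / g e e)) *\<^sub>R e"
    using skew_on_orthogonal_basis[OF skew(1) ef mem(1,2)] by blast
  obtain c where L: "L e = c *\<^sub>R f" "L f = (- c * (g f f / g e e)) *\<^sub>R e"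
    using skew_on_orthogonal_basis[OF skew(2) ef mem(3,4)] by blast
  obtain \<alpha> \<beta> where "p = \<alpha> *\<^sub>R e + \<beta> *\<^sub>R f" using p unfolding span by (rule span_pair_cases)
  then show ?thesis
    by (simp add: linear_add lin linear_diff linear_scale K L mult_ac)
qed

section \<open>Orthogonal direct sums\<close>

definition orthogonal_sets :: "'a set \<Rightarrow> 'a set \<Rightarrow> bool" where
  "orthogonal_sets S T \<longleftrightarrow> (\<forall>x\<in>S. \<forall>y\<in>T. g x y = 0)"

lemma orthogonal_sets_span_Union:
  assumes "\<And>T. T \<in> \<V> \<Longrightarrow> orthogonal_sets S T"
  shows "orthogonal_sets S (span (\<Union>\<V>))"
proof -
  have "S \<subseteq> orthogonal_complement (\<Union>\<V>)"
    using assms by (auto simp: orthogonal_sets_def orthogonal_complement_def)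
  then have "S \<subseteq> orthogonal_complement (span (\<Union>\<V>))"
    by (simp only: orthogonal_complement_span)
  then show ?thesis by (auto simp: orthogonal_sets_def orthogonal_complement_def)
qed

text \<open>
  The difference of the first components lies in the first summand and in the span of the others, so it
  is orthogonal to itself.
\<close>

lemma orthogonal_components_unique:
  assumes "sorted_wrt orthogonal_sets Vs" "\<forall>S\<in>set Vs. subspace S"
    and "list_all2 (\<in>) xs Vs" "list_all2 (\<in>) ys Vs" "sum_list xs = sum_list ys"
  shows "xs = ys"
  using assms
proof (induction Vs arbitrary: xs ys)
  case (Cons V Vs)
  obtain x xs' y ys' where xy: "xs = x # xs'" "ys = y # ys'"
    and mem: "x \<in> V" "y \<in> V" "list_all2 (\<in>) xs' Vs" "list_all2 (\<in>) ys' Vs"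
    using Cons.prems(3,4) by (auto simp: list_all2_Cons2)
  have eq: "x - y = sum_list ys' - sum_list xs'"
    using Cons.prems(5) xy by (simp add: algebra_simps)
  have "x - y \<in> V" using mem(1,2) Cons.prems(2) by (simp add: subspace_diff)
  moreover have "x - y \<in> span (\<Union>(set Vs))"
    unfolding eq by (intro span_diff sum_list_in_span_Union mem)
  moreover have "orthogonal_sets V (span (\<Union>(set Vs)))"
    using Cons.prems(1) by (intro orthogonal_sets_span_Union) simp
  ultimately have "g (x - y) (x - y) = 0" by (simp only: orthogonal_sets_def)
  then have "x = y" unfolding form_self_eq_0 by simp
  moreover have "xs' = ys'"
    using Cons.prems(1,2) mem(3,4) eq \<open>x = y\<close> by (intro Cons.IH) auto
  ultimately show ?case by (simp add: xy)
qed simp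

lemma orthogonal_direct_sumI:
  assumes "\<forall>S\<in>set Vs. subspace S" "sorted_wrt orthogonal_sets Vs"
    and "\<And>x. \<exists>xs. list_all2 (\<in>) xs Vs \<and> x = sum_list xs"
  shows "orthogonal_direct_sum g Vs"
  unfolding orthogonal_direct_sum_def
proof (intro conjI allI impI ballI)
  show "\<exists>!xs. list_all2 (\<in>) xs Vs \<and> x = sum_list xs" for x
    using assms(3)[of x] orthogonal_components_unique[OF assms(2,1)] by blast
next
  fix i j x y
  assume "i < length Vs" "j < length Vs" "i \<noteq> j" "x \<in> Vs ! i" "y \<in> Vs ! j"
  then show "g x y = 0"
    using assms(2) symmetric[of x y]
    by (metis linorder_neqE_nat sorted_wrt_iff_nth_less orthogonal_sets_def)
qed (use assms(1) in blast)

text \<open>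
  Pairing \<open>r\<close> with its own component in another summand gives the squared length of that component.
\<close>

lemma orthogonal_to_others_imp_in_summand:
  assumes dsum: "orthogonal_direct_sum g Us" and i: "i < length Us"
    and perp: "\<And>j w. j < length Us \<Longrightarrow> j \<noteq> i \<Longrightarrow> w \<in> Us ! j \<Longrightarrow> g r w = 0"
  shows "r \<in> Us ! i"
proof -
  obtain rs where rs: "list_all2 (\<in>) rs Us" "r = sum_list rs"
    using dsum unfolding orthogonal_direct_sum_def by blast
  have len: "length rs = length Us" using rs(1) by (rule list_all2_lengthD)
  have mem: "rs ! j \<in> Us ! j" if "j < length Us" for j
    using list_all2_nthD2[OF rs(1) that] .
  have r: "r = (\<Sum>k<length Us. rs ! k)"
    by (simp add: rs(2) sum_list_sum_nth len atLeast0LessThan)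
  have zero: "rs ! j = 0" if j: "j < length Us" "j \<noteq> i" for j
  proof -
    have orth: "g (rs ! k) (rs ! j) = 0" if "k < length Us" "k \<noteq> j" for k
      using dsum j(1) that mem[OF that(1)] mem[OF j(1)] unfolding orthogonal_direct_sum_def by blast
    have "linear (\<lambda>x. g x (rs ! j))" by (rule linearI) simp_all
    then have "g r (rs ! j) = (\<Sum>k<length Us. g (rs ! k) (rs ! j))"
      unfolding r by (rule linear_sum)
    also have "\<dots> = (\<Sum>k<length Us. if k = j then g (rs ! j) (rs ! j) else 0)"
      by (intro sum.cong refl) (auto simp: orth)
    also have "\<dots> = g (rs ! j) (rs ! j)" using j(1) by simp
    finally have "g (rs ! j) (rs ! j) = 0" using perp[OF j mem[OF j(1)]] by simp
    then show ?thesis unfolding form_self_eq_0 .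
  qed
  have "r = (\<Sum>k<length Us. if k = i then rs ! i else 0)"
    unfolding r by (intro sum.cong refl) (auto simp: zero)
  then have "r = rs ! i" using i by simp
  with mem[OF i] show ?thesis by simp
qed

end

section \<open>The curvature operators of a Riemannian model\<close>

sublocale riemannian_zero_model \<subseteq> euclidean_form g
  by unfold_locales
    (use finite_dimensional bilinear_form symmetric_form positive_definite in auto)

context riemannian_zero_model begin

abbreviation R :: "'a \<Rightarrow> 'a \<Rightarrow> 'a \<Rightarrow> 'a" where
  "R \<equiv> skew_curvature_operator g A"

lemma curvature_linear:
  "linear (\<lambda>t. A t x y z)" "linear (\<lambda>t. A x t y z)" "linear (\<lambda>t. A x y t z)" "linear (\<lambda>t. A x y z t)"
proof -
  have "quadrilinear_on UNIV A"
    using curvature_tensor unfolding algebraic_curvature_tensor_on_def by blast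
  then show
    "linear (\<lambda>t. A t x y z)" "linear (\<lambda>t. A x t y z)" "linear (\<lambda>t. A x y t z)" "linear (\<lambda>t. A x y z t)"
    by (simp_all add: quadrilinear_on_def linear_form_on_def linear_iff)
qed

lemmas curvature_add =
  curvature_linear(1)[THEN linear_add] curvature_linear(2)[THEN linear_add]
  curvature_linear(3)[THEN linear_add] curvature_linear(4)[THEN linear_add]

lemmas curvature_scale =
  curvature_linear(1)[THEN linear_scale] curvature_linear(2)[THEN linear_scale]
  curvature_linear(3)[THEN linear_scale] curvature_linear(4)[THEN linear_scale]

lemmas curvature_0 =
  curvature_linear(1)[THEN linear_0] curvature_linear(2)[THEN linear_0]
  curvature_linear(3)[THEN linear_0] curvature_linear(4)[THEN linear_0]

lemma curvature_pair_symmetry: "A x y z w = A z w x y"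
  and curvature_skew: "A x y z w = - A y x z w"
  and bianchi: "A x y z w + A y z x w + A z x y w = 0"
  using curvature_tensor unfolding algebraic_curvature_tensor_on_def by blast+

lemma curvature_skew': "A x y z w = - A x y w z"
  using curvature_pair_symmetry[of x y z w] curvature_skew[of z w x y] curvature_pair_symmetry[of w z x y]
  by (simp only:)

lemma curvature_tensor_on: "algebraic_curvature_tensor_on S A"
proof -
  have "linear_form_on S f" if "linear f" for f
    using that by (simp add: linear_form_on_def linear_add linear_scale)
  then have "quadrilinear_on S A"
    by (simp add: quadrilinear_on_def curvature_linear)
  then show ?thesis
    unfolding algebraic_curvature_tensor_on_def
    by (intro conjI ballI curvature_pair_symmetry curvature_skew bianchi)
qed

lemma form_operator: "g (R x y z) w = A x y z w"
  using theI'[OF riesz_representation[OF curvature_linear(4)[of x y z]]]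
  unfolding skew_curvature_operator_def by blast

lemma operator_linear: "linear (R x y)"
  by (rule linearI; rule form_eqI) (simp_all add: form_operator curvature_add curvature_scale)

lemma operator_skew: "g (R x y z) w = - g z (R x y w)"
  using curvature_skew'[of x y z w] by (simp add: form_operator symmetric[of z])

section \<open>Invariant subspaces and splittings of the tensor\<close>

definition curvature_invariant :: "'a set \<Rightarrow> bool" where
  "curvature_invariant S \<longleftrightarrow> (\<forall>x y. R x y ` S \<subseteq> S)"

lemma curvature_invariantD: "curvature_invariant S \<Longrightarrow> z \<in> S \<Longrightarrow> R x y z \<in> S"
  by (auto simp: curvature_invariant_def)

lemma invariant_span:
  assumes "\<And>x y z. z \<in> S \<Longrightarrow> R x y z \<in> span S"
  shows "curvature_invariant (span S)"
proof -
  have "R x y z \<in> span S" if "z \<in> span S" for x y z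
    using that
    by (induction rule: span_induct_alt)
      (auto simp: linear_0 linear_add linear_scale operator_linear intro: assms span_zero span_add span_scale)
  then show ?thesis by (auto simp: curvature_invariant_def)
qed

lemma invariant_span_Union:
  assumes "\<And>T. T \<in> \<V> \<Longrightarrow> curvature_invariant T"
  shows "curvature_invariant (span (\<Union>\<V>))"
proof (rule invariant_span)
  fix x y z assume "z \<in> \<Union>\<V>"
  then obtain T where "T \<in> \<V>" "z \<in> T" by blast
  then have "R x y z \<in> \<Union>\<V>" using curvature_invariantD[OF assms] by blast
  then show "R x y z \<in> span (\<Union>\<V>)" by (rule span_base)
qed

lemma invariant_orthogonal_complement:
  assumes "curvature_invariant S"
  shows "curvature_invariant (orthogonal_complement S)"
proof -
  have "g (R x y z) w = 0" if "z \<in> orthogonal_complement S" "w \<in> S" for x y z w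
    using that(1) curvature_invariantD[OF assms that(2)] by (simp add: operator_skew orthogonal_complement_def)
  then show ?thesis unfolding curvature_invariant_def orthogonal_complement_def by blast
qed

lemma invariant_Int: "curvature_invariant S \<Longrightarrow> curvature_invariant T \<Longrightarrow> curvature_invariant (S \<inter> T)"
  unfolding curvature_invariant_def by blast

text \<open>
  All fourteen mixed entries vanish.  Invariance and orthogonality handle those in which the last two or
  the first two arguments are separated; the Bianchi identity reduces the rest, with both pairs pure but
  in different summands, to the separated ones.
\<close>

lemma curvature_splits:
  assumes inv: "curvature_invariant S" "curvature_invariant T" and orth: "orthogonal_sets S T"
    and S: "x \<in> S" "y \<in> S" "z \<in> S" "w \<in> S" and T: "x' \<in> T" "y' \<in> T" "z' \<in> T" "w' \<in> T"
  shows "A (x + x') (y + y') (z + z') (w + w') = A x y z w + A x' y' z' w'"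
proof -
  have 1: "A a b c d = 0" if "c \<in> S" "d \<in> T" for a b c d
    using that inv(1) orth by (simp add: form_operator[symmetric] orthogonal_sets_def curvature_invariantD)
  have 2: "A a b c d = 0" if "c \<in> T" "d \<in> S" for a b c d
    using 1[OF that(2,1)] curvature_skew'[of a b c d] by simp
  have 3: "A a b c d = 0" if "a \<in> S" "b \<in> T" for a b c d
    using 1[OF that] curvature_pair_symmetry[of a b c d] by simp
  have 4: "A a b c d = 0" if "a \<in> T" "b \<in> S" for a b c d
    using 2[OF that] curvature_pair_symmetry[of a b c d] by simp
  have 5: "A a b c d = 0" if "a \<in> S" "b \<in> S" "c \<in> T" for a b c d
    using bianchi[of a b c d] 3[OF that(2,3)] 4[OF that(3,1)] by simp
  have 6: "A a b c d = 0" if "a \<in> T" "b \<in> T" "c \<in> S" for a b c d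
    using bianchi[of a b c d] 4[OF that(2,3)] 3[OF that(3,1)] by simp
  show ?thesis
    using S T by (simp add: curvature_add 1 2 3 4 5 6)
qed

text \<open>
  The span of the remaining summands is invariant and orthogonal to the first one, so the two-summand
  case iterates.
\<close>

lemma curvature_of_sum_lists:
  assumes "sorted_wrt orthogonal_sets Vs" "\<forall>S\<in>set Vs. curvature_invariant S"
    and "list_all2 (\<in>) xs Vs" "list_all2 (\<in>) ys Vs" "list_all2 (\<in>) zs Vs" "list_all2 (\<in>) ws Vs"
  shows "A (sum_list xs) (sum_list ys) (sum_list zs) (sum_list ws) =
    (\<Sum>i<length Vs. A (xs ! i) (ys ! i) (zs ! i) (ws ! i))"
  using assms
proof (induction Vs arbitrary: xs ys zs ws)
  case Nil
  then show ?case by (simp add: curvature_0)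
next
  case (Cons V Vs)
  from Cons.prems obtain x xs' y ys' z zs' w ws' where
    eqs: "xs = x # xs'" "ys = y # ys'" "zs = z # zs'" "ws = w # ws'"
    and mem: "x \<in> V" "y \<in> V" "z \<in> V" "w \<in> V"
    and tails: "list_all2 (\<in>) xs' Vs" "list_all2 (\<in>) ys' Vs" "list_all2 (\<in>) zs' Vs" "list_all2 (\<in>) ws' Vs"
    by (auto simp: list_all2_Cons2)
  let ?U = "span (\<Union>(set Vs))"
  have "orthogonal_sets V ?U" "curvature_invariant V" "curvature_invariant ?U"
    using Cons.prems(1,2) by (auto intro!: orthogonal_sets_span_Union invariant_span_Union)
  moreover have "sum_list xs' \<in> ?U" "sum_list ys' \<in> ?U" "sum_list zs' \<in> ?U" "sum_list ws' \<in> ?U"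
    by (intro sum_list_in_span_Union tails)+
  ultimately show ?case
    using mem Cons.IH[OF _ _ tails] Cons.prems(1,2)
    by (simp add: eqs curvature_splits[where S = V and T = ?U] sum.lessThan_Suc_shift del: sum.lessThan_Suc)
qed

lemma invariant_decomposition:
  assumes "subspace S" "curvature_invariant S"
  shows "orthogonal_direct_sum g [S, orthogonal_complement S]"
    and "decomposes_tensor [S, orthogonal_complement S] A [A, A]"
proof -
  let ?Vs = "[S, orthogonal_complement S]"
  have orth: "sorted_wrt orthogonal_sets ?Vs"
    by (simp add: orthogonal_sets_def orthogonal_complement_def) (metis symmetric)
  have "\<exists>xs. list_all2 (\<in>) xs ?Vs \<and> x = sum_list xs" for x
  proof -
    obtain p where "p \<in> S" "x - p \<in> orthogonal_complement S"
      using orthogonal_projection_exists[OF assms(1)] by blast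
    then show ?thesis by (intro exI[of _ "[p, x - p]"]) simp
  qed
  with orth show "orthogonal_direct_sum g ?Vs"
    using assms(1) subspace_orthogonal_complement by (intro orthogonal_direct_sumI) auto
  show "decomposes_tensor ?Vs A [A, A]"
    unfolding decomposes_tensor_def
  proof (intro conjI allI impI)
    fix xs ys zs ws
    assume "list_all2 (\<in>) xs ?Vs \<and> list_all2 (\<in>) ys ?Vs \<and> list_all2 (\<in>) zs ?Vs \<and> list_all2 (\<in>) ws ?Vs"
    then have "A (sum_list xs) (sum_list ys) (sum_list zs) (sum_list ws) =
        (\<Sum>i<length ?Vs. A (xs ! i) (ys ! i) (zs ! i) (ws ! i))"
      using orth assms(2) invariant_orthogonal_complement[OF assms(2)]
      by (intro curvature_of_sum_lists) auto
    also have "\<dots> = (\<Sum>i<length ?Vs. ([A, A] ! i) (xs ! i) (ys ! i) (zs ! i) (ws ! i))"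
      by (simp add: numeral_2_eq_2)
    finally show "A (sum_list xs) (sum_list ys) (sum_list zs) (sum_list ws) =
        (\<Sum>i<length ?Vs. ([A, A] ! i) (xs ! i) (ys ! i) (zs ! i) (ws ! i))" .
  qed (simp add: curvature_tensor_on)
qed

text \<open>
  Otherwise \<open>S\<close> and its nonzero orthogonal complement would decompose the model.
\<close>

lemma indecomposable_invariant_subspace:
  assumes "\<not> decomposable g A" "subspace S" "curvature_invariant S" "S \<noteq> {0}"
  shows "S = UNIV"
proof -
  have comp: "orthogonal_complement S = {0}"
  proof (rule ccontr)
    assume "orthogonal_complement S \<noteq> {0}"
    with assms(4) invariant_decomposition[OF assms(2,3)] have "decomposable g A"
      unfolding decomposable_def by (intro exI conjI)
    with assms(1) show False by contradiction
  qed
  have "x \<in> S" for x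
    using orthogonal_projection_exists[OF assms(2), of x] comp by auto
  then show ?thesis by blast
qed

section \<open>Skew Tsankov models split into planes\<close>

lemma tsankov_commute:
  assumes "skew_tsankov g A"
  shows "R x y (R u v z) = R u v (R x y z)"
proof -
  from fun_cong[OF assms[unfolded skew_tsankov_def, rule_format, of x y u v], of z] show ?thesis by (simp only: comp_apply)
qed

text \<open>
  Write \<open>J = R s t\<close>.  The common eigenvector \<open>v\<close> of all products \<open>R x y \<circ> R u w\<close> is taken in the image of
  \<open>J\<close>, which meets the kernel of the skew-adjoint \<open>J\<close> trivially; so \<open>w = J v\<close> is nonzero, and it is
  orthogonal to \<open>v\<close>.  Every \<open>R x y\<close> maps \<open>w\<close> to a multiple of \<open>v\<close>, because \<open>R x y \<circ> J\<close> is one of the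
  products, and commuting past \<open>J\<close> shows that it maps \<open>v\<close> to a multiple of \<open>w\<close>.
\<close>

lemma tsankov_invariant_plane:
  assumes ts: "skew_tsankov g A" and U: "subspace U" "curvature_invariant U"
    and not_flat: "a \<in> U" "R s t a \<noteq> 0"
  shows "\<exists>P\<subseteq>U. subspace P \<and> dim P = 2 \<and> curvature_invariant P"
proof -
  let ?J = "R s t"
  note lin = operator_linear[THEN linear_0] operator_linear[THEN linear_add] operator_linear[THEN linear_scale]
  define F where "F = {R x y \<circ> R u v | x y u v. True}"
  have "\<exists>v\<in>?J ` U. v \<noteq> 0 \<and> (\<forall>T\<in>F. \<exists>c. T v = c *\<^sub>R v)"
  proof (rule common_eigenvector)
    fix T assume "T \<in> F"
    then obtain x y u v where T: "T = R x y \<circ> R u v" unfolding F_def by blast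
    show "linear T" unfolding T by (simp add: linear_compose operator_linear)
    show "g (T x) y = g x (T y)" for x y
      by (simp add: T operator_skew tsankov_commute[OF ts])
    show "T ` ?J ` U \<subseteq> ?J ` U"
    proof -
      have "T (?J z) = ?J (T z)" for z by (simp add: T tsankov_commute[OF ts, of _ _ s t])
      moreover have "T z \<in> U" if "z \<in> U" for z using that U(2) by (simp add: T curvature_invariantD)
      ultimately show ?thesis by auto
    qed
  next
    fix S T x assume "S \<in> F" "T \<in> F"
    then obtain a b c d p q r s where "S = R a b \<circ> R c d" "T = R p q \<circ> R r s"
      unfolding F_def by blast
    then show "S (T x) = T (S x)" by (simp add: tsankov_commute[OF ts])
  next
    show "subspace (?J ` U)" using operator_linear U(1) by (rule linear_subspace_image)
    show "?J ` U \<noteq> {0}" using not_flat by blast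
  qed
  then obtain v where v: "v \<in> ?J ` U" "v \<noteq> 0" "\<And>T. T \<in> F \<Longrightarrow> \<exists>c. T v = c *\<^sub>R v" by blast
  then obtain b where b: "b \<in> U" "v = ?J b" by blast
  have eig: "\<exists>c. R x y (R u w v) = c *\<^sub>R v" for x y u w
    using v(3)[of "R x y \<circ> R u w"] by (auto simp: F_def)
  define w where "w = ?J v"
  have "w \<noteq> 0"
  proof
    assume "w = 0"
    then have "g (?J b) (?J b) = 0" using b(2) by (simp add: operator_skew w_def)
    with b v(2) show False by simp
  qed
  have "v \<in> U" "w \<in> U" using b U(2) by (simp_all add: w_def curvature_invariantD)
  have vw: "g v w = 0" using operator_skew[of s t v v] symmetric[of w v] by (simp add: w_def)
  obtain \<kappa> where \<kappa>: "?J w = \<kappa> *\<^sub>R v" unfolding w_def using eig by blast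
  have "\<kappa> \<noteq> 0"
  proof
    assume "\<kappa> = 0"
    then have "g w w = 0" using operator_skew[of s t v w] \<kappa> by (simp add: w_def)
    with \<open>w \<noteq> 0\<close> show False by simp
  qed
  have "R x y v \<in> span {v, w} \<and> R x y w \<in> span {v, w}" for x y
  proof -
    obtain \<mu> where \<mu>: "R x y w = \<mu> *\<^sub>R v" unfolding w_def using eig by blast
    have "\<kappa> *\<^sub>R R x y v = R x y (?J w)" by (simp add: \<kappa> lin)
    also have "\<dots> = \<mu> *\<^sub>R w" by (simp only: tsankov_commute[OF ts, of x y s t w] \<mu> lin w_def[symmetric])
    finally have "R x y v = (\<mu> / \<kappa>) *\<^sub>R w"
      using \<open>\<kappa> \<noteq> 0\<close> by (metis divide_inverse_commute scaleR_scaleR scaleR_one left_inverse)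
    with \<mu> show ?thesis by (simp add: span_scale span_base)
  qed
  then have "curvature_invariant (span {v, w})" by (intro invariant_span) auto
  moreover have "span {v, w} \<subseteq> U" using U(1) \<open>v \<in> U\<close> \<open>w \<in> U\<close> by (simp add: span_minimal)
  ultimately show ?thesis
    using dim_span_orthogonal_pair[OF v(2) \<open>w \<noteq> 0\<close> vw] subspace_span by blast
qed

text \<open>
  The induction needs the statement inside an arbitrary invariant \<open>U\<close>: after one plane is removed, the
  construction continues in its complement within \<open>U\<close>, until all operators vanish there.
\<close>

lemma tsankov_orthogonal_planes:
  assumes ts: "skew_tsankov g A" and U: "subspace U" "curvature_invariant U"
  shows "\<exists>Vs W. sorted_wrt orthogonal_sets (Vs @ [W]) \<and>
    (\<forall>S\<in>set Vs. subspace S \<and> dim S = 2 \<and> curvature_invariant S) \<and>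
    subspace W \<and> (\<forall>x y. \<forall>z\<in>W. R x y z = 0) \<and> (\<forall>S\<in>set (Vs @ [W]). S \<subseteq> U) \<and>
    (\<forall>x\<in>U. \<exists>xs. list_all2 (\<in>) xs (Vs @ [W]) \<and> x = sum_list xs)"
  using U
proof (induction "dim U" arbitrary: U rule: less_induct)
  case less
  show ?case
  proof (cases "\<forall>x y. \<forall>z\<in>U. R x y z = 0")
    case True
    have "\<exists>xs. list_all2 (\<in>) xs [U] \<and> x = sum_list xs" if "x \<in> U" for x
      using that by (intro exI[of _ "[x]"]) simp
    with True less.prems(1) show ?thesis by (intro exI[of _ "[]"] exI[of _ U]) simp
  next
    case False
    then obtain P where P: "P \<subseteq> U" "subspace P" "dim P = 2" "curvature_invariant P"
      using tsankov_invariant_plane[OF ts less.prems] by blast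
    define U' where "U' = U \<inter> orthogonal_complement P"
    have U': "subspace U'" "curvature_invariant U'"
      unfolding U'_def using less.prems P(4)
      by (auto intro: subspace_inter subspace_orthogonal_complement invariant_Int invariant_orthogonal_complement)
    obtain e where e: "e \<in> P" "e \<noteq> 0" using P(3) dim_pos_imp_nonzero_vector[of P] by auto
    then have "g e e \<noteq> 0" by simp
    with e(1) have "e \<notin> U'" unfolding U'_def orthogonal_complement_def by blast
    with e P(1) have "U' \<subset> U" by (auto simp: U'_def)
    then have "dim U' < dim U" using U'(1) less.prems(1) by (intro dim_psubspace)
    from less.hyps[OF this U'] obtain Vs W where
      VW: "sorted_wrt orthogonal_sets (Vs @ [W])"
        "\<forall>S\<in>set Vs. subspace S \<and> dim S = 2 \<and> curvature_invariant S"
        "subspace W" "\<forall>x y. \<forall>z\<in>W. R x y z = 0" "\<forall>S\<in>set (Vs @ [W]). S \<subseteq> U'"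
        "\<forall>x\<in>U'. \<exists>xs. list_all2 (\<in>) xs (Vs @ [W]) \<and> x = sum_list xs"
      by blast
    have "orthogonal_sets P U'"
      by (auto simp: orthogonal_sets_def U'_def orthogonal_complement_def symmetric)
    then have "\<forall>S\<in>set (Vs @ [W]). orthogonal_sets P S"
      using VW(5) unfolding orthogonal_sets_def by blast
    then have "sorted_wrt orthogonal_sets ((P # Vs) @ [W])" using VW(1) by simp
    moreover have "\<forall>S\<in>set (P # Vs). subspace S \<and> dim S = 2 \<and> curvature_invariant S" using VW(2) P by simp
    moreover have "\<forall>S\<in>set ((P # Vs) @ [W]). S \<subseteq> U" using VW(5) P(1) by (auto simp: U'_def)
    moreover have "\<exists>xs. list_all2 (\<in>) xs ((P # Vs) @ [W]) \<and> x = sum_list xs" if "x \<in> U" for x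
    proof -
      obtain p where p: "p \<in> P" "x - p \<in> orthogonal_complement P"
        using orthogonal_projection_exists[OF P(2)] by blast
      then have "x - p \<in> U'" using that P(1) less.prems(1) by (auto simp: U'_def intro: subspace_diff)
      then obtain xs where "list_all2 (\<in>) xs (Vs @ [W])" "x - p = sum_list xs" using VW(6) by blast
      then show ?thesis using p(1) by (intro exI[of _ "p # xs"]) (simp add: algebra_simps)
    qed
    ultimately show ?thesis using VW(3,4) by blast
  qed
qed

text \<open>
  The tensor \<open>A\<close> itself serves as each \<open>A\<^sub>i\<close>, since only its values on the summand count; on \<open>W\<close> it is
  zero because the operators kill \<open>W\<close>.
\<close>

lemma tsankov_imp_decomposition:
  assumes ts: "skew_tsankov g A"
  shows "\<exists>Vs W As. orthogonal_direct_sum g (Vs @ [W]) \<and>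
    decomposes_tensor (Vs @ [W]) A (As @ [zero_tensor]) \<and> (\<forall>S\<in>set Vs. dim S = 2)"
proof -
  obtain Vs W where
    VW: "sorted_wrt orthogonal_sets (Vs @ [W])"
      "\<forall>S\<in>set Vs. subspace S \<and> dim S = 2 \<and> curvature_invariant S"
      "subspace W" "\<forall>x y. \<forall>z\<in>W. R x y z = 0"
      "\<forall>x\<in>UNIV. \<exists>xs. list_all2 (\<in>) xs (Vs @ [W]) \<and> x = sum_list xs"
    using tsankov_orthogonal_planes[OF ts subspace_UNIV] by (auto simp: curvature_invariant_def)
  let ?Vs = "Vs @ [W]" and ?As = "replicate (length Vs) A @ [zero_tensor]"
  have inv: "\<forall>S\<in>set ?Vs. curvature_invariant S"
    using VW(2,3,4) by (auto simp: curvature_invariant_def subspace_0)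
  have "algebraic_curvature_tensor_on W zero_tensor"
    by (simp add: algebraic_curvature_tensor_on_def quadrilinear_on_def linear_form_on_def zero_tensor_def)
  then have "list_all2 algebraic_curvature_tensor_on ?Vs ?As"
    by (intro list_all2_appendI) (simp_all add: list_all2_conv_all_nth curvature_tensor_on)
  moreover have "A (sum_list xs) (sum_list ys) (sum_list zs) (sum_list ws) =
      (\<Sum>i<length ?Vs. (?As ! i) (xs ! i) (ys ! i) (zs ! i) (ws ! i))"
    if "list_all2 (\<in>) xs ?Vs" "list_all2 (\<in>) ys ?Vs" "list_all2 (\<in>) zs ?Vs" "list_all2 (\<in>) ws ?Vs"
    for xs ys zs ws
  proof -
    have "A x y (zs ! length Vs) w = 0" for x y w
      using VW(4) list_all2_nthD2[OF that(3), of "length Vs"] form_operator[of x y "zs ! length Vs" w]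
      by simp
    then show ?thesis
      unfolding curvature_of_sum_lists[OF VW(1) inv that]
      by (simp add: nth_append zero_tensor_def)
  qed
  ultimately have "decomposes_tensor ?Vs A ?As" by (simp only: decomposes_tensor_def) blast
  moreover have "orthogonal_direct_sum g ?Vs" using VW by (intro orthogonal_direct_sumI) auto
  ultimately show ?thesis using VW(2) by blast
qed

section \<open>Models that split into planes are skew Tsankov\<close>

text \<open>
  Only the \<open>i\<close>-th component of a vector of the \<open>i\<close>-th summand is nonzero.
\<close>

lemma curvature_on_summand:
  assumes dsum: "orthogonal_direct_sum g Us" and dec: "decomposes_tensor Us A Bs"
    and xs: "list_all2 (\<in>) xs Us" and ys: "list_all2 (\<in>) ys Us" and ws: "list_all2 (\<in>) ws Us"
    and i: "i < length Us" and z: "z \<in> Us ! i"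
  shows "A (sum_list xs) (sum_list ys) z (sum_list ws) = (Bs ! i) (xs ! i) (ys ! i) z (ws ! i)"
proof -
  define zs where "zs = (replicate (length Us) 0)[i := z]"
  have zs: "list_all2 (\<in>) zs Us" "sum_list zs = z"
    using dsum i z unfolding zs_def orthogonal_direct_sum_def
    by (auto intro: single_in_summands simp: sum_list_single)
  have summand: "(Bs ! k) (xs ! k) (ys ! k) (zs ! k) (ws ! k) =
      (if k = i then (Bs ! i) (xs ! i) (ys ! i) z (ws ! i) else 0)" if k: "k < length Us" for k
  proof (cases "k = i")
    case False
    then have "zs ! k = 0" using k by (simp add: zs_def)
    moreover have "xs ! k \<in> Us ! k" "ys ! k \<in> Us ! k" "ws ! k \<in> Us ! k"
      using list_all2_nthD2[OF _ k] xs ys ws by blast+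
    ultimately show ?thesis
      using False decomposes_tensor_zero_argument(1)[OF dec k] by simp
  qed (use i in \<open>simp add: zs_def\<close>)
  have "A (sum_list xs) (sum_list ys) (sum_list zs) (sum_list ws) =
      (\<Sum>k<length Us. (Bs ! k) (xs ! k) (ys ! k) (zs ! k) (ws ! k))"
    using dec xs ys zs(1) ws unfolding decomposes_tensor_def by blast
  also have "\<dots> = (\<Sum>k<length Us. if k = i then (Bs ! i) (xs ! i) (ys ! i) z (ws ! i) else 0)"
    by (intro sum.cong refl summand) simp
  finally show ?thesis using i by (simp add: zs(2))
qed

text \<open>
  For \<open>z\<close> in one summand and \<open>w\<close> in another, each \<open>A\<^sub>k\<close> has a zero argument, so \<open>R x y z\<close> is orthogonal
  to all other summands.
\<close>

lemma summand_invariant: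
  assumes dsum: "orthogonal_direct_sum g Us" and dec: "decomposes_tensor Us A Bs"
    and i: "i < length Us"
  shows "curvature_invariant (Us ! i)"
proof -
  have "R x y z \<in> Us ! i" if z: "z \<in> Us ! i" for x y z
  proof (rule orthogonal_to_others_imp_in_summand[OF dsum i])
    fix j w assume j: "j < length Us" "j \<noteq> i" "w \<in> Us ! j"
    have sub: "\<forall>S\<in>set Us. subspace S"
      and ex: "\<And>x. \<exists>xs. list_all2 (\<in>) xs Us \<and> x = sum_list xs"
      using dsum unfolding orthogonal_direct_sum_def by blast+
    obtain xs ys where xs: "list_all2 (\<in>) xs Us" "x = sum_list xs"
      and ys: "list_all2 (\<in>) ys Us" "y = sum_list ys"
      using ex by meson
    have mem: "xs ! i \<in> Us ! i" "ys ! i \<in> Us ! i"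
      using list_all2_nthD2[OF _ i] xs(1) ys(1) by blast+
    define ws where "ws = (replicate (length Us) 0)[j := w]"
    have ws: "list_all2 (\<in>) ws Us" "sum_list ws = w"
      using sub j unfolding ws_def by (simp_all add: single_in_summands sum_list_single)
    have "ws ! i = 0" using i j(2) by (simp add: ws_def)
    then show "g (R x y z) w = 0"
      using curvature_on_summand[OF dsum dec xs(1) ys(1) ws(1) i z] xs(2) ys(2) ws(2) decomposes_tensor_zero_argument(2)[OF dec i mem z]
      by (simp add: form_operator)
  qed
  then show ?thesis by (auto simp: curvature_invariant_def)
qed

lemma tsankovI: "(\<And>x y u v z. R x y (R u v z) = R u v (R x y z)) \<Longrightarrow> skew_tsankov g A"
  unfolding skew_tsankov_def by (intro allI ext) (simp only: comp_apply)

lemma operators_commute_on_invariant_plane: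
  assumes "subspace P" "dim P = 2" "curvature_invariant P" "z \<in> P"
  shows "R x y (R u v z) = R u v (R x y z)"
proof -
  have "R x y ` P \<subseteq> P" "R u v ` P \<subseteq> P" using assms(3) unfolding curvature_invariant_def by blast+
  then show ?thesis
    using skew_operators_commute_on_plane[OF operator_linear operator_linear operator_skew operator_skew]
      assms by blast
qed

text \<open>
  The operators commute on each invariant plane and vanish on \<open>W\<close>; linearity extends this to sums.
\<close>

lemma decomposition_imp_tsankov:
  assumes dsum: "orthogonal_direct_sum g (Vs @ [W])"
    and dec: "decomposes_tensor (Vs @ [W]) A (As @ [zero_tensor])"
    and dims: "\<forall>S\<in>set Vs. dim S = 2"
  shows "skew_tsankov g A"
proof (rule tsankovI)
  let ?Us = "Vs @ [W]"
  have sub: "\<forall>S\<in>set ?Us. subspace S"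
    and ex: "\<And>x. \<exists>xs. list_all2 (\<in>) xs ?Us \<and> x = sum_list xs"
    using dsum unfolding orthogonal_direct_sum_def by blast+
  have "length As = length Vs"
    using dec list_all2_lengthD unfolding decomposes_tensor_def by fastforce
  then have last: "(As @ [zero_tensor]) ! length Vs = zero_tensor" by (metis nth_append_length)
  have zero: "zero_tensor a b c d = 0" for a b c d :: 'a by (simp add: zero_tensor_def)
  have flat: "R x y z = 0" if z: "z \<in> W" for x y z
  proof (rule form_eqI)
    fix w
    obtain xs ys ws where "list_all2 (\<in>) xs ?Us" "x = sum_list xs"
      "list_all2 (\<in>) ys ?Us" "y = sum_list ys" "list_all2 (\<in>) ws ?Us" "w = sum_list ws"
      using ex by meson
    then show "g (R x y z) w = g 0 w"
      using curvature_on_summand[OF dsum dec, of xs ys ws "length Vs" z] z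
      by (simp add: form_operator last zero)
  qed
  fix x y u v z
  obtain zs where zs: "list_all2 (\<in>) zs ?Us" "z = sum_list zs" using ex by blast
  have "(R x y \<circ> R u v) (sum_list zs) = (R u v \<circ> R x y) (sum_list zs)"
  proof (rule linear_eq_on_sum_list)
    fix a assume "a \<in> set zs"
    then obtain i where i: "i < length ?Us" "a \<in> ?Us ! i"
      using zs(1) by (metis in_set_conv_nth list_all2_conv_all_nth)
    show "(R x y \<circ> R u v) a = (R u v \<circ> R x y) a"
    proof (cases "i < length Vs")
      case True
      then have "Vs ! i \<in> set Vs" "?Us ! i = Vs ! i" by (simp_all add: nth_append)
      then show ?thesis
        using operators_commute_on_invariant_plane[of "Vs ! i" a] sub dims i
          summand_invariant[OF dsum dec i(1)] by auto
    next
      case False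
      then have "a \<in> W" using i by (simp add: nth_append split: if_splits)
      then show ?thesis by (simp add: flat linear_0[OF operator_linear])
    qed
  qed (intro linear_compose operator_linear)+
  then show "R x y (R u v z) = R u v (R x y z)" by (simp add: zs(2))
qed

section \<open>Indecomposable models\<close>

text \<open>
  Nonzero vectors \<open>e\<close>, \<open>f\<close> from the two summands span the plane, and \<open>A e f\<close> vanishes by pair symmetry:
  \<open>R z w e\<close> stays in the first summand and is orthogonal to \<open>f\<close>.  By skewness every entry of \<open>A\<close> is
  a multiple of an entry of \<open>A e f\<close>.
\<close>

lemma two_dimensional_decomposable_flat:
  assumes dim: "dim (UNIV :: 'a set) = 2" and "decomposable g A"
  shows "A = zero_tensor"
proof -
  obtain V1 V2 A1 A2 where V: "V1 \<noteq> {0}" "V2 \<noteq> {0}"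
    and dsum: "orthogonal_direct_sum g [V1, V2]" and dec: "decomposes_tensor [V1, V2] A [A1, A2]"
    using assms(2) unfolding decomposable_def by blast
  have sub: "subspace V1" "subspace V2"
    using dsum by (simp_all add: orthogonal_direct_sum_def)
  obtain e f where e: "e \<in> V1" "e \<noteq> 0" and f: "f \<in> V2" "f \<noteq> 0"
    using V sub subspace_0 by blast
  have inv: "curvature_invariant V1" "curvature_invariant V2"
    using summand_invariant[OF dsum dec, of 0] summand_invariant[OF dsum dec, of 1] by simp_all
  have "\<forall>i<length [V1, V2]. \<forall>j<length [V1, V2]. i \<noteq> j \<longrightarrow> (\<forall>x\<in>[V1, V2] ! i. \<forall>y\<in>[V1, V2] ! j. g x y = 0)"
    using dsum unfolding orthogonal_direct_sum_def by blast
  from this[rule_format, of 0 1] have orth: "g x y = 0" if "x \<in> V1" "y \<in> V2" for x y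
    using that by simp
  have "\<not> span {e, f} \<subset> UNIV"
    using dim_psubspace[OF subspace_span subspace_UNIV, of "{e, f}"]
      dim_span_orthogonal_pair[OF e(2) f(2) orth[OF e(1) f(1)]] dim by (metis less_irrefl)
  then have all: "x \<in> span {e, f}" for x by blast
  have "A x y e f = 0" for x y
    using orth curvature_invariantD[OF inv(1) e(1)] f(1) by (simp add: form_operator[symmetric])
  then have ef: "A e f z w = 0" for z w
    by (simp add: curvature_pair_symmetry[of e f])
  have fe: "A f e z w = 0" for z w using curvature_skew[of f e z w] ef by simp
  have diag: "A x x z w = 0" for x z w using curvature_skew[of x x z w] by simp
  have "A x y z w = 0" for x y z w
  proof -
    obtain a b c d where "x = a *\<^sub>R e + b *\<^sub>R f" "y = c *\<^sub>R e + d *\<^sub>R f"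
      using span_pair_cases[OF all[of x]] span_pair_cases[OF all[of y]] by metis
    then show ?thesis
      by (simp add: curvature_add curvature_scale ef fe diag)
  qed
  then show ?thesis by (simp add: zero_tensor_def fun_eq_iff)
qed

lemma operator_nonzero_exists:
  assumes "A \<noteq> zero_tensor"
  shows "\<exists>x y z. R x y z \<noteq> 0"
proof (rule ccontr)
  assume *: "\<nexists>x y z. R x y z \<noteq> 0"
  have "A x y z w = 0" for x y z w
    using * form_operator[of x y z w] by simp
  with assms show False by (simp add: zero_tensor_def fun_eq_iff)
qed

text \<open>
  If \<open>A\<close> were zero, a line would be invariant, hence everything, contrary to \<open>dim \<ge> 2\<close>.  Otherwise
  the invariant plane is the whole space.
\<close>

lemma indecomposable_tsankov_two_dimensional:
  assumes ts: "skew_tsankov g A" and indec: "\<not> decomposable g A"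
    and dim: "dim (UNIV :: 'a set) \<ge> 2"
  shows "dim (UNIV :: 'a set) = 2" "A \<noteq> zero_tensor"
proof -
  show nonzero: "A \<noteq> zero_tensor"
  proof
    assume "A = zero_tensor"
    then have flat: "R x y z = 0" for x y z
      using form_operator[of x y z "R x y z"] by (simp add: zero_tensor_def)
    obtain e :: 'a where e: "e \<noteq> 0" using dim_pos_imp_nonzero_vector[of "UNIV :: 'a set"] dim by auto
    have "curvature_invariant (span {e})" by (simp add: invariant_span flat span_0)
    moreover have "span {e} \<noteq> {0}" using e span_base[of e "{e}"] by auto
    ultimately have "span {e} = UNIV"
      using indecomposable_invariant_subspace[OF indec subspace_span] by blast
    moreover have "dim (span {e}) \<le> 1" using dim_le_card[of "span {e}" "{e}"] by simp
    ultimately show False using dim by simp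
  qed
  then obtain x y z where "R x y z \<noteq> 0" using operator_nonzero_exists by blast
  then obtain P where P: "subspace P" "dim P = 2" "curvature_invariant P"
    using tsankov_invariant_plane[OF ts subspace_UNIV, of z x y] by (auto simp: curvature_invariant_def)
  have "P \<noteq> {0}" using P(2) dim_pos_imp_nonzero_vector[of P] by auto
  then have "P = UNIV" using indecomposable_invariant_subspace[OF indec P(1,3)] by blast
  with P(2) show "dim (UNIV :: 'a set) = 2" by simp
qed

lemma two_dimensional_tsankov: "dim (UNIV :: 'a set) = 2 \<Longrightarrow> skew_tsankov g A"
  by (rule tsankovI, rule operators_commute_on_invariant_plane[OF subspace_UNIV])
    (simp_all add: curvature_invariant_def)

end

theorem theorem2p1:
  fixes g :: "'a::real_vector \<Rightarrow> 'a \<Rightarrow> real"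
    and A :: "'a tensor4"
  assumes "riemannian_zero_model g A"
  shows "(skew_tsankov g A \<longleftrightarrow>
           (\<exists>Vs W As. orthogonal_direct_sum g (Vs @ [W]) \<and>
              decomposes_tensor (Vs @ [W]) A (As @ [zero_tensor]) \<and>
              (\<forall>S\<in>set Vs. dim S = 2))) \<and>
         (dim (UNIV :: 'a set) \<ge> 2 \<longrightarrow>
           (skew_tsankov g A \<and> \<not> decomposable g A \<longleftrightarrow>
              dim (UNIV :: 'a set) = 2 \<and> A \<noteq> zero_tensor))"
proof -
  interpret riemannian_zero_model g A by fact
  show ?thesis
    using tsankov_imp_decomposition decomposition_imp_tsankov indecomposable_tsankov_two_dimensional
      two_dimensional_tsankov two_dimensional_decomposable_flat by blast
qed

end
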